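(* The admissible state set $$\mathcal G_0=\Big\{\mathbf U=(D,\mathbf m,\mathbf B,E)^\top\in\mathbb R^8\ \Big|\ D>0,\ q(\mathbf U)>0,\ \Psi(\mathbf U)>0\Big\}$$ is a convex set.
   Context: Here $D,E\in\mathbb R$, $\mathbf m,\mathbf B\in\mathbb R^3$, and $$q(\mathbf U)=E-\sqrt{D^2+|\mathbf m|^2},\qquad \Phi(\mathbf U)=\sqrt{(|\mathbf B|^2-E)^2+3(E^2-D^2-|\mathbf m|^2)},$$ $$\Psi(\mathbf U)=\Big(\Phi(\mathbf U)-2(|\mathbf B|^2-E)\Big)\sqrt{\Phi(\mathbf U)+|\mathbf B|^2-E}-\sqrt{\tfrac{27}{2}\big(D^2|\mathbf B|^2+(\mathbf m\cdot\mathbf B)^2\big)}.$$ The condition $\Psi(\mathbf U)>0$ is imposed for $\mathbf U$ with $q(\mathbf U)>0$, for which all the square roots are of nonnegative numbers. *)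

theory Defs
  imports "HOL-Analysis.Analysis"
begin

text \<open>
  A state \<open>(D, m, B, E)\<close> is an element of the eight-dimensional real vector space
  \<open>\<real> \<times> \<real>\<^sup>3 \<times> \<real>\<^sup>3 \<times> \<real>\<close>, with the componentwise product structure.
\<close>

type_synonym state = "real \<times> (real ^ 3) \<times> (real ^ 3) \<times> real"

fun q :: "state \<Rightarrow> real" where
  "q (D, m, B, E) = E - sqrt (D\<^sup>2 + (norm m)\<^sup>2)"

fun Phi :: "state \<Rightarrow> real" where
  "Phi (D, m, B, E) = sqrt (((norm B)\<^sup>2 - E)\<^sup>2 + 3 * (E\<^sup>2 - D\<^sup>2 - (norm m)\<^sup>2))"

fun Psi :: "state \<Rightarrow> real" where
  "Psi (D, m, B, E) =
     (Phi (D, m, B, E) - 2 * ((norm B)\<^sup>2 - E)) * sqrt (Phi (D, m, B, E) + (norm B)\<^sup>2 - E)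
     - sqrt (27 / 2 * (D\<^sup>2 * (norm B)\<^sup>2 + (m \<bullet> B)\<^sup>2))"

definition G0 :: "state set" where
  "G0 = {(D, m, B, E) | D m B E. D > 0 \<and> q (D, m, B, E) > 0 \<and> Psi (D, m, B, E) > 0}"

text \<open>
  The library's \<^const>\<open>sqrt\<close> is total and odd, hence negative on negative arguments. On states with
  \<open>q > 0\<close> all radicands are nonnegative, so this extension plays no role in \<^const>\<open>G0\<close>.
\<close>

lemma radicands_nonneg:
  assumes "q (D, m, B, E) > 0"
  shows "D\<^sup>2 + (norm m)\<^sup>2 \<ge> 0"
    and "((norm B)\<^sup>2 - E)\<^sup>2 + 3 * (E\<^sup>2 - D\<^sup>2 - (norm m)\<^sup>2) \<ge> 0"
    and "Phi (D, m, B, E) + (norm B)\<^sup>2 - E \<ge> 0"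
    and "27 / 2 * (D\<^sup>2 * (norm B)\<^sup>2 + (m \<bullet> B)\<^sup>2) \<ge> 0"
proof -
  have "(sqrt (D\<^sup>2 + (norm m)\<^sup>2))\<^sup>2 < E\<^sup>2"
    using assms by (intro power_strict_mono) auto
  then have pos: "E\<^sup>2 - D\<^sup>2 - (norm m)\<^sup>2 > 0"
    by simp
  then show "((norm B)\<^sup>2 - E)\<^sup>2 + 3 * (E\<^sup>2 - D\<^sup>2 - (norm m)\<^sup>2) \<ge> 0"
    by (intro add_nonneg_nonneg) auto
  have "sqrt (((norm B)\<^sup>2 - E)\<^sup>2) \<le> Phi (D, m, B, E)"
    using pos unfolding Phi.simps by (intro real_sqrt_le_mono) simp
  then have "\<bar>(norm B)\<^sup>2 - E\<bar> \<le> Phi (D, m, B, E)"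
    by (simp only: real_sqrt_abs)
  then show "Phi (D, m, B, E) + (norm B)\<^sup>2 - E \<ge> 0"
    by linarith
qed auto

end

theory Submission
  imports Defs
begin

text \<open>
  Why the set is convex. Write \<open>M = (D, m) \<in> \<real>\<^sup>4\<close>. The square roots in \<^const>\<open>Psi\<close> hide the maximum
  of a cubic: for \<open>q > 0\<close>, the condition \<open>Psi > 0\<close> holds iff some \<open>\<lambda> > |B|\<^sup>2\<close> satisfies
  \<open>(\<lambda> - |B|\<^sup>2) (2 E \<lambda> - \<lambda>\<^sup>2 - |M|\<^sup>2) > D\<^sup>2 |B|\<^sup>2 + (m \<bullet> B)\<^sup>2\<close>. Here \<^const>\<open>Phi\<close> is the root of the
  discriminant of the derivative of this cubic, so its larger critical point is
  \<open>(2 E + |B|\<^sup>2 + Phi) / 3\<close> (lemma \<open>cubic_positive_iff\<close>).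

  Divided by \<open>\<lambda> (\<lambda> - |B|\<^sup>2)\<close>, the cubic inequality becomes
  \<open>2 E > \<lambda> + M \<bullet> (\<lambda> I - A)\<^sup>-\<^sup>1 M\<close>, where \<open>A\<close> is the matrix of the quadratic form
  \<open>(w, v) \<mapsto> w\<^sup>2 |B|\<^sup>2 + (v \<bullet> B)\<^sup>2\<close>. As \<open>\<lambda> I - A\<close> is positive definite,
  \<open>M \<bullet> (\<lambda> I - A)\<^sup>-\<^sup>1 M\<close> is the maximum over \<open>z\<close> of \<open>2 M \<bullet> z - z \<bullet> (\<lambda> I - A) z\<close>. This
  frees the inequality of all nonlinearity except squares of linear functions of \<open>B\<close>: it says that
  \<open>E\<close> exceeds, for every \<open>z = (w, v)\<close>, the function \<open>dual_bound w v\<close> below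
  (lemma \<open>mem_G0_iff_dual_bound\<close>).

  For fixed \<open>z\<close> that function is jointly convex in \<open>(\<lambda>, D, m, B)\<close>, and so is \<open>|B|\<^sup>2\<close>. Hence the
  pairs \<open>(\<lambda>, U)\<close> that satisfy the conditions form a convex set, and \<^const>\<open>G0\<close> is its projection.
\<close>

section \<open>The square roots as the maximum of a cubic\<close>

text \<open>
  With \<open>c = (2 E + b) / 3\<close> and \<open>s > 0\<close> the cubic has critical points \<open>c \<plusminus> s / 3\<close>. The identity compares it with
  its value at the local maximum \<open>c + s / 3\<close>, which is a double root of the difference.
\<close>
lemma cubic_about_maximum:
  fixes E b N s l :: real
  assumes "s\<^sup>2 = (b - E)\<^sup>2 + 3 * (E\<^sup>2 - N)"
  shows "(l - b) * (2 * E * l - l\<^sup>2 - N) =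
         2 * (s + 2 * (E - b))\<^sup>2 * (s + b - E) / 27
         - (l - (2 * E + b + s) / 3)\<^sup>2 * (l - (2 * E + b) / 3 + 2 * s / 3)"
proof -
  define x y where "x = l - (2 * E + b + s) / 3" and "y = l - (2 * E + b) / 3 + 2 * s / 3"
  have "3 * x = 3 * l - (2 * E + b + s)" "3 * y = 3 * l - (2 * E + b) + 2 * s"
    by (simp_all add: x_def y_def field_simps)
  then have "27 * ((l - b) * (2 * E * l - l\<^sup>2 - N)) =
      2 * (s + 2 * (E - b))\<^sup>2 * (s + b - E) - 27 * (x\<^sup>2 * y)"
    using assms by algebra
  then show ?thesis
    unfolding x_def y_def by linarith
qed

lemma cubic_positive_iff:
  fixes E b N K s :: real
  assumes "N < E\<^sup>2" and "K \<ge> 0"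
    and s: "s = sqrt ((b - E)\<^sup>2 + 3 * (E\<^sup>2 - N))"
  shows "(s - 2 * (b - E)) * sqrt (s + b - E) - sqrt (27 / 2 * K) > 0 \<longleftrightarrow>
         (\<exists>l>b. (l - b) * (2 * E * l - l\<^sup>2 - N) > K)"
    (is "?lhs \<longleftrightarrow> ?rhs")
proof -
  have s2: "s\<^sup>2 = (b - E)\<^sup>2 + 3 * (E\<^sup>2 - N)"
    using assms by simp
  have s0: "s \<ge> 0"
    using assms by simp
  have "\<bar>b - E\<bar> < s"
    using assms real_sqrt_less_mono[of "(b - E)\<^sup>2" "(b - E)\<^sup>2 + 3 * (E\<^sup>2 - N)"] by simp
  then have pos: "s + b - E > 0"
    by linarith
  note cubic = cubic_about_maximum[OF s2]
  have square: "((s - 2 * (b - E)) * sqrt (s + b - E))\<^sup>2 = (s + 2 * (E - b))\<^sup>2 * (s + b - E)"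
  proof -
    have "s - 2 * (b - E) = s + 2 * (E - b)"
      by simp
    then show ?thesis
      using pos by (simp only: power_mult_distrib) simp
  qed
  show ?thesis
  proof
    assume ?lhs
    then have gt: "(s - 2 * (b - E)) * sqrt (s + b - E) > sqrt (27 / 2 * K)"
      by simp
    moreover have root_nonneg: "sqrt (27 / 2 * K) \<ge> 0"
      using \<open>K \<ge> 0\<close> by simp
    ultimately have "(s - 2 * (b - E)) * sqrt (s + b - E) > 0"
      by linarith
    then have factor: "s - 2 * (b - E) > 0"
      using pos by (simp add: zero_less_mult_iff)
    have "(sqrt (27 / 2 * K))\<^sup>2 < ((s - 2 * (b - E)) * sqrt (s + b - E))\<^sup>2"
      using gt root_nonneg by (intro power_strict_mono) auto
    then have "27 / 2 * K < (s + 2 * (E - b))\<^sup>2 * (s + b - E)"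
      using \<open>K \<ge> 0\<close> unfolding square by simp
    then have "K < 2 * (s + 2 * (E - b))\<^sup>2 * (s + b - E) / 27"
      by linarith
    then have "K < (l - b) * (2 * E * l - l\<^sup>2 - N)" if "l = (2 * E + b + s) / 3" for l
      unfolding cubic that by simp
    moreover have "(2 * E + b + s) / 3 > b"
      using factor by (simp add: field_simps)
    ultimately show ?rhs
      by blast
  next
    assume ?rhs
    then obtain l where l: "l > b" "(l - b) * (2 * E * l - l\<^sup>2 - N) > K"
      by blast
    \<comment> \<open>The other root of the difference in the cubic identity lies below \<open>b\<close>, so the local maximum
      dominates the cubic on all of \<open>l > b\<close>.\<close>
    have "l - (2 * E + b) / 3 + 2 * s / 3 \<ge> 0"
      using l(1) pos by (simp add: field_simps)
    then have "(l - (2 * E + b + s) / 3)\<^sup>2 * (l - (2 * E + b) / 3 + 2 * s / 3) \<ge> 0"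
      by simp
    then have bound: "27 / 2 * K < (s + 2 * (E - b))\<^sup>2 * (s + b - E)"
      using l(2) unfolding cubic by linarith
    \<comment> \<open>Squaring has lost the sign of \<open>s - 2 * (b - E)\<close>. If it were not positive, then no root of
      \<open>2 * E * x - x\<^sup>2 - N\<close> would exceed \<open>b\<close>, so this factor would be negative at \<open>l\<close>.\<close>
    have factor: "s - 2 * (b - E) > 0"
    proof (rule ccontr)
      assume neg: "\<not> ?thesis"
      then have "s\<^sup>2 \<le> (2 * (b - E))\<^sup>2"
        using s0 by (intro power_mono) auto
      then have "E\<^sup>2 - N \<le> (b - E)\<^sup>2"
        unfolding s2 power_mult_distrib by simp
      also have "(b - E)\<^sup>2 \<le> (l - E)\<^sup>2"
        using neg s0 l(1) by (intro power_mono) auto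
      finally have "2 * E * l - l\<^sup>2 - N \<le> 0"
        by (simp add: power2_diff algebra_simps)
      then have "(l - b) * (2 * E * l - l\<^sup>2 - N) \<le> 0"
        using l(1) by (simp add: mult_nonneg_nonpos)
      then show False
        using l(2) \<open>K \<ge> 0\<close> by linarith
    qed
    have "sqrt (27 / 2 * K) < sqrt ((s + 2 * (E - b))\<^sup>2 * (s + b - E))"
      using bound by simp
    also have "\<dots> = (s - 2 * (b - E)) * sqrt (s + b - E)"
      using factor pos unfolding square[symmetric] by simp
    finally show ?lhs
      by simp
  qed
qed

section \<open>Variational form of the admissibility condition\<close>

text \<open>
  The Lagrangian, with multiplier \<open>l / 2\<close>, for maximizing
  \<open>D * w + m \<bullet> v + (w\<^sup>2 |B|\<^sup>2 + (v \<bullet> B)\<^sup>2) / 2\<close> over the unit sphere \<open>w\<^sup>2 + |v|\<^sup>2 = 1\<close>. Its last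
  summand is the magnetic pressure of a flow with velocity \<open>v\<close> and Lorentz factor \<open>1 / w\<close>.
\<close>
definition dual_bound ::
    "real \<Rightarrow> real ^ 3 \<Rightarrow> real \<Rightarrow> real \<Rightarrow> real ^ 3 \<Rightarrow> real ^ 3 \<Rightarrow> real" where
  "dual_bound w v l D m B =
     l / 2 * (1 - w\<^sup>2 - (norm v)\<^sup>2) + D * w + m \<bullet> v + (w\<^sup>2 * (norm B)\<^sup>2 + (v \<bullet> B)\<^sup>2) / 2"

text \<open>
  The assumptions say that \<open>(D, m)\<close> is the image of \<open>(w\<^sub>0, v\<^sub>0)\<close> under \<open>l I - A\<close>, that is, the
  gradient of the bound in \<open>(w, v)\<close> vanishes there. The subtracted quadratic form is that of
  \<open>l I - A\<close>, so for \<open>l > |B|\<^sup>2\<close> this point is the maximizer.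
\<close>
lemma dual_bound_complete_square:
  fixes v v0 B :: "real ^ 3"
  assumes D: "D = (l - (norm B)\<^sup>2) * w0" and m: "m = l *\<^sub>R v0 - (v0 \<bullet> B) *\<^sub>R B"
  shows "dual_bound w v l D m B = (l + D * w0 + m \<bullet> v0) / 2
         - ((l - (norm B)\<^sup>2) * (w - w0)\<^sup>2 + l * (norm (v - v0))\<^sup>2 - ((v - v0) \<bullet> B)\<^sup>2) / 2"
proof -
  have "m \<bullet> v = l * (v0 \<bullet> v) - (v0 \<bullet> B) * (v \<bullet> B)"
    and "m \<bullet> v0 = l * (norm v0)\<^sup>2 - (v0 \<bullet> B)\<^sup>2"
    by (simp_all add: m inner_diff_left inner_commute[of B] power2_norm_eq_inner
        power2_eq_square[of "v0 \<bullet> B"])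
  moreover have "(norm (v - v0))\<^sup>2 = (norm v)\<^sup>2 - 2 * (v0 \<bullet> v) + (norm v0)\<^sup>2"
    by (simp add: power2_norm_eq_inner inner_diff_left inner_diff_right inner_commute)
  moreover have "(v - v0) \<bullet> B = v \<bullet> B - v0 \<bullet> B"
    by (rule inner_diff_left)
  moreover have "2 * dual_bound w v l D m B = l * (1 - w\<^sup>2 - (norm v)\<^sup>2) + 2 * (D * w)
      + 2 * (m \<bullet> v) + w\<^sup>2 * (norm B)\<^sup>2 + (v \<bullet> B)\<^sup>2"
    by (simp add: dual_bound_def)
  ultimately have "2 * dual_bound w v l D m B = l + D * w0 + m \<bullet> v0
      - ((l - (norm B)\<^sup>2) * (w - w0)\<^sup>2 + l * (norm (v - v0))\<^sup>2 - ((v - v0) \<bullet> B)\<^sup>2)"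
    using D by algebra
  then show ?thesis
    by argo
qed

text \<open>
  The inverse of \<open>l I - B B\<^sup>T\<close> is \<open>(I + B B\<^sup>T / (l - |B|\<^sup>2)) / l\<close>, which gives the maximizer
  explicitly. That \<open>E\<close> exceeds the maximal value becomes the cubic inequality after multiplication
  by \<open>2 l (l - |B|\<^sup>2) > 0\<close>.
\<close>
lemma dual_bound_less_iff_cubic:
  fixes m B :: "real ^ 3"
  assumes l: "l > (norm B)\<^sup>2"
  shows "(\<forall>w v. dual_bound w v l D m B < E) \<longleftrightarrow>
         D\<^sup>2 * (norm B)\<^sup>2 + (m \<bullet> B)\<^sup>2 <
           (l - (norm B)\<^sup>2) * (2 * E * l - l\<^sup>2 - (D\<^sup>2 + (norm m)\<^sup>2))"
proof -
  define b where "b = (norm B)\<^sup>2"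
  define w0 where "w0 = D / (l - b)"
  define v0 where "v0 = (1 / l) *\<^sub>R (m + ((m \<bullet> B) / (l - b)) *\<^sub>R B)"
  have b: "b \<ge> 0" "l > b" "l > 0" "l - b > 0"
    using l zero_le_power2[of "norm B"] unfolding b_def by linarith+
  have BB: "B \<bullet> B = b"
    by (simp add: b_def power2_norm_eq_inner)
  have v0B: "v0 \<bullet> B = (m \<bullet> B) / (l - b)"
    using b by (simp add: v0_def inner_add_left BB field_simps)
  have D: "D = (l - (norm B)\<^sup>2) * w0"
    using b by (simp add: w0_def b_def[symmetric])
  have m: "m = l *\<^sub>R v0 - (v0 \<bullet> B) *\<^sub>R B"
    using b unfolding v0B by (simp add: v0_def)
  note square = dual_bound_complete_square[OF D m]
  define top where "top = (l + D * w0 + m \<bullet> v0) / 2"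
  have le_top: "dual_bound w v l D m B \<le> top" for w v
  proof -
    have "((v - v0) \<bullet> B)\<^sup>2 \<le> b * (norm (v - v0))\<^sup>2"
      using Cauchy_Schwarz_ineq[of "v - v0" B]
      by (simp add: b_def power2_norm_eq_inner mult.commute)
    also have "\<dots> \<le> l * (norm (v - v0))\<^sup>2"
      using b by (intro mult_right_mono) auto
    finally have "((v - v0) \<bullet> B)\<^sup>2 \<le> l * (norm (v - v0))\<^sup>2" .
    moreover have "(l - (norm B)\<^sup>2) * (w - w0)\<^sup>2 \<ge> 0"
      using l by simp
    ultimately show ?thesis
      unfolding square top_def by argo
  qed
  have attained: "dual_bound w0 v0 l D m B = top"
    unfolding square top_def by simp
  have w0: "(l - b) * w0 = D"
    using b by (simp add: w0_def)
  have mv0: "l * (l - b) * (m \<bullet> v0) = (l - b) * (norm m)\<^sup>2 + (m \<bullet> B)\<^sup>2"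
    using b by (simp add: v0_def inner_add_right power2_norm_eq_inner
        power2_eq_square[of "m \<bullet> B"] distrib_left)
  have "2 * l * (l - b) * top = l * (l - b) * (l + D * w0 + m \<bullet> v0)"
    by (simp add: top_def)
  also have "\<dots> = l\<^sup>2 * (l - b) + l * D * ((l - b) * w0) + l * (l - b) * (m \<bullet> v0)"
    by (simp add: algebra_simps power2_eq_square)
  also have "\<dots> = l\<^sup>2 * (l - b) + l * D\<^sup>2 + ((l - b) * (norm m)\<^sup>2 + (m \<bullet> B)\<^sup>2)"
    unfolding w0 mv0 by (simp add: power2_eq_square)
  finally have gap: "2 * l * (l - b) * (E - top) =
      (l - b) * (2 * E * l - l\<^sup>2 - (D\<^sup>2 + (norm m)\<^sup>2)) - (D\<^sup>2 * b + (m \<bullet> B)\<^sup>2)"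
    by (simp add: algebra_simps)
  have "(\<forall>w v. dual_bound w v l D m B < E) \<longleftrightarrow> top < E"
    using le_top attained by (metis order_le_less_trans)
  also have "\<dots> \<longleftrightarrow> 0 < 2 * l * (l - b) * (E - top)"
    using b by (simp add: zero_less_mult_iff mult_less_0_iff)
  also have "\<dots> \<longleftrightarrow> D\<^sup>2 * b + (m \<bullet> B)\<^sup>2 < (l - b) * (2 * E * l - l\<^sup>2 - (D\<^sup>2 + (norm m)\<^sup>2))"
    unfolding gap by simp
  finally show ?thesis
    unfolding b_def .
qed

text \<open>
  On the unit sphere the multiplier term vanishes and the magnetic term is nonnegative, so the
  unit vector in direction \<open>(D, m)\<close> gives \<open>E > |(D, m)|\<close>.
\<close>
lemma q_pos_if_dual_bound:
  assumes "D > 0" and bound: "\<And>w v. dual_bound w v l D m B < E"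
  shows "q (D, m, B, E) > 0"
proof -
  define r where "r = sqrt (D\<^sup>2 + (norm m)\<^sup>2)"
  have r2: "r\<^sup>2 = D\<^sup>2 + (norm m)\<^sup>2"
    by (simp add: r_def)
  have r: "r > 0"
    using \<open>D > 0\<close> by (simp add: r_def add_pos_nonneg)
  have "(D / r)\<^sup>2 + (norm ((1 / r) *\<^sub>R m))\<^sup>2 = r\<^sup>2 / r\<^sup>2"
    unfolding r2 add_divide_distrib by (simp add: power_divide r2)
  then have sphere: "1 - (D / r)\<^sup>2 - (norm ((1 / r) *\<^sub>R m))\<^sup>2 = 0"
    using r by simp
  have "D * (D / r) + m \<bullet> ((1 / r) *\<^sub>R m) = r\<^sup>2 / r"
    using r unfolding r2 by (simp add: power2_norm_eq_inner power2_eq_square[of D] add_divide_distrib)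
  also have "\<dots> = r"
    using r by (simp add: power2_eq_square)
  finally have lin: "D * (D / r) + m \<bullet> ((1 / r) *\<^sub>R m) = r" .
  have "r \<le> dual_bound (D / r) ((1 / r) *\<^sub>R m) l D m B"
    unfolding dual_bound_def sphere using lin by simp
  also have "\<dots> < E"
    by (rule bound)
  finally show ?thesis
    by (simp add: r_def)
qed

lemma mem_G0_iff_dual_bound:
  "(D, m, B, E) \<in> G0 \<longleftrightarrow>
     D > 0 \<and> (\<exists>l>(norm B)\<^sup>2. \<forall>w v. dual_bound w v l D m B < E)"
proof -
  let ?K = "D\<^sup>2 * (norm B)\<^sup>2 + (m \<bullet> B)\<^sup>2" and ?N = "D\<^sup>2 + (norm m)\<^sup>2"
  have Psi_iff: "Psi (D, m, B, E) > 0 \<longleftrightarrow> (\<exists>l>(norm B)\<^sup>2. \<forall>w v. dual_bound w v l D m B < E)"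
    if "q (D, m, B, E) > 0"
  proof -
    have "(sqrt ?N)\<^sup>2 < E\<^sup>2"
      using that by (intro power_strict_mono) auto
    then have "?N < E\<^sup>2"
      by simp
    moreover have "?K \<ge> 0"
      by simp
    moreover have "Phi (D, m, B, E) = sqrt (((norm B)\<^sup>2 - E)\<^sup>2 + 3 * (E\<^sup>2 - ?N))"
      by (simp add: algebra_simps)
    ultimately have "Psi (D, m, B, E) > 0 \<longleftrightarrow>
        (\<exists>l>(norm B)\<^sup>2. (l - (norm B)\<^sup>2) * (2 * E * l - l\<^sup>2 - ?N) > ?K)"
      unfolding Psi.simps by (rule cubic_positive_iff)
    then show ?thesis
      using dual_bound_less_iff_cubic by blast
  qed
  have "(D, m, B, E) \<in> G0 \<longleftrightarrow> D > 0 \<and> q (D, m, B, E) > 0 \<and> Psi (D, m, B, E) > 0"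
    by (simp add: G0_def del: q.simps Psi.simps)
  then show ?thesis
    using Psi_iff q_pos_if_dual_bound by blast
qed

section \<open>Joint convexity\<close>

lemma convex_combination_power2_le:
  fixes x y s t :: real
  assumes "s \<ge> 0" "t \<ge> 0" "s + t = 1"
  shows "(s * x + t * y)\<^sup>2 \<le> s * x\<^sup>2 + t * y\<^sup>2"
  using convex_onD[OF convex_power2, of t x y] assms
  by (simp add: eq_diff_eq[symmetric])

lemma convex_combination_norm_power2_le:
  fixes x y :: "'a :: real_normed_vector"
  assumes "s \<ge> 0" "t \<ge> 0" "s + t = 1"
  shows "(norm (s *\<^sub>R x + t *\<^sub>R y))\<^sup>2 \<le> s * (norm x)\<^sup>2 + t * (norm y)\<^sup>2"
proof -
  have "norm (s *\<^sub>R x + t *\<^sub>R y) \<le> s * norm x + t * norm y"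
    using norm_triangle_ineq[of "s *\<^sub>R x" "t *\<^sub>R y"] assms by simp
  then have "(norm (s *\<^sub>R x + t *\<^sub>R y))\<^sup>2 \<le> (s * norm x + t * norm y)\<^sup>2"
    by (intro power_mono) auto
  also have "\<dots> \<le> s * (norm x)\<^sup>2 + t * (norm y)\<^sup>2"
    by (rule convex_combination_power2_le[OF assms])
  finally show ?thesis .
qed

lemma dual_bound_convex:
  assumes st: "s \<ge> 0" "t \<ge> 0" "s + t = 1"
  shows "dual_bound w v (s * l1 + t * l2) (s * D1 + t * D2)
           (s *\<^sub>R m1 + t *\<^sub>R m2) (s *\<^sub>R B1 + t *\<^sub>R B2)
         \<le> s * dual_bound w v l1 D1 m1 B1 + t * dual_bound w v l2 D2 m2 B2"
proof -
  let ?B = "s *\<^sub>R B1 + t *\<^sub>R B2"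
  have "w\<^sup>2 * (norm ?B)\<^sup>2 \<le> w\<^sup>2 * (s * (norm B1)\<^sup>2 + t * (norm B2)\<^sup>2)"
    by (intro mult_left_mono convex_combination_norm_power2_le[OF st]) simp
  moreover have "(v \<bullet> ?B)\<^sup>2 \<le> s * (v \<bullet> B1)\<^sup>2 + t * (v \<bullet> B2)\<^sup>2"
    using convex_combination_power2_le[OF st, of "v \<bullet> B1" "v \<bullet> B2"] by (simp add: inner_add_right)
  ultimately show ?thesis
    unfolding dual_bound_def by (simp add: inner_add_left field_simps)
qed

lemma convex_combination_less:
  fixes x y x' y' s t :: real
  assumes "s \<ge> 0" "t \<ge> 0" "s + t = 1" "x < x'" "y < y'"
  shows "s * x + t * y < s * x' + t * y'"
proof (cases "s = 0")
  case False
  then have "s * x < s * x'"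
    using assms by simp
  moreover have "t * y \<le> t * y'"
    using assms by (intro mult_left_mono) auto
  ultimately show ?thesis
    by linarith
qed (use assms in simp)

text \<open>
  The multipliers of two states are combined with the same weights as the states themselves: this
  is the projection argument for the convex set of pairs of a multiplier and a state.
\<close>
theorem theorem2p2:
  shows "convex G0"
proof (rule convexI)
  fix U1 U2 :: state and s t :: real
  assume U: "U1 \<in> G0" "U2 \<in> G0" and st: "0 \<le> s" "0 \<le> t" "s + t = 1"
  obtain D1 m1 B1 E1 where U1: "U1 = (D1, m1, B1, E1)"
    by (cases U1)
  obtain D2 m2 B2 E2 where U2: "U2 = (D2, m2, B2, E2)"
    by (cases U2)
  obtain l1 where 1: "D1 > 0" "(norm B1)\<^sup>2 < l1" "\<And>w v. dual_bound w v l1 D1 m1 B1 < E1"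
    using U(1) unfolding U1 mem_G0_iff_dual_bound by blast
  obtain l2 where 2: "D2 > 0" "(norm B2)\<^sup>2 < l2" "\<And>w v. dual_bound w v l2 D2 m2 B2 < E2"
    using U(2) unfolding U2 mem_G0_iff_dual_bound by blast
  let ?D = "s * D1 + t * D2" and ?m = "s *\<^sub>R m1 + t *\<^sub>R m2" and ?B = "s *\<^sub>R B1 + t *\<^sub>R B2"
    and ?E = "s * E1 + t * E2" and ?l = "s * l1 + t * l2"
  have "?D > 0"
    using convex_combination_less[OF st 1(1) 2(1)] by simp
  moreover have "(norm ?B)\<^sup>2 < ?l"
    using convex_combination_norm_power2_le[OF st, of B1 B2]
      convex_combination_less[OF st 1(2) 2(2)] by linarith
  moreover have "dual_bound w v ?l ?D ?m ?B < ?E" for w v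
    using dual_bound_convex[OF st] convex_combination_less[OF st 1(3) 2(3)]
    by (rule order_le_less_trans)
  ultimately have "(?D, ?m, ?B, ?E) \<in> G0"
    unfolding mem_G0_iff_dual_bound by blast
  then show "s *\<^sub>R U1 + t *\<^sub>R U2 \<in> G0"
    by (simp add: U1 U2)
qed

end
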